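(* Let $K$ be a locally compact field with a nontrivial non-Archimedean absolute value, with ring of integers $\mathcal{O}$, residue field of order $q$, and normalized Haar measure $\mu$. If $f:\mathcal{O}\to\mathbb{R}$ is a continuous, Haar-integrable function and $X$ is a finite nonempty subset of $\mathcal{O}$ with discrepancy $\Delta(X)$, then \[\left|\frac{1}{|X|}\sum_{x\in X}f(x)-\int_{\mathcal{O}}f\,d\mu\right|\le\left(1+\frac1q\right)V_{\mathrm{Berk}}(f)\,\Delta(X).\]
   Context: $\mathcal{O}=\{x\in K:|x|\le1\}$, $\pi$ a uniformizer, $q$ the order of $\mathcal{O}/\pi\mathcal{O}$, $|\pi|=1/q$; $\mu$ is Haar measure on $\mathcal{O}$ with $\mu(\mathcal{O})=1$. A disc is $D_r(a)=\{x\in K:|x-a|\le r\}$, $r\in q^{\mathbb{Z}}$, $r>0$. Discrepancy: $\Delta(X)=\sup_{D\subseteq\mathcal{O}}\left|\frac{|X\cap D|}{|X|}-\mu(D)\right|$ over all discs $D\subseteq\mathcal{O}$. Berkovich-analytic variation: let $\mathcal{D}_{\mathcal{O}}$ be the set of discs contained in $\mathcal{O}$; $D'\prec D$ means $D'\subseteq D$ and $\mu(D')=\mu(D)/q$; $f(D)=\frac{1}{\mu(D)}\int_D f\,d\mu$; $V_{\mathrm{Berk}}(f)=\sum_{D\in\mathcal{D}_{\mathcal{O}}}\sum_{D'\prec D}|f(D')-f(D)|$. *)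

theory Defs
  imports "HOL-Analysis.Analysis"
begin

text \<open>The metric is the one given by the absolute value, so that \<open>cball a r\<close> is the disc of
  radius \<open>r\<close> about \<open>a\<close>. Definiteness and nonnegativity of \<open>absval\<close> are implied by the metric
  axioms. (The library's \<open>norm\<close> is constrained to real vector spaces.)\<close>

class nonarch_valued_field = field + metric_space +
  fixes absval :: "'a \<Rightarrow> real"
  assumes dist_absval: "dist x y = absval (x - y)"
    and absval_mult: "absval (x * y) = absval x * absval y"
    and absval_ultrametric: "absval (x + y) \<le> max (absval x) (absval y)"
    and absval_nontrivial: "\<exists>x. x \<noteq> 0 \<and> absval x \<noteq> 1"

definition valuation_ring :: "'a::nonarch_valued_field set" where
  "valuation_ring = {x. absval x \<le> 1}"

definition valuation_ideal :: "'a::nonarch_valued_field set" where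
  "valuation_ideal = {x. absval x < 1}"

definition uniformizer :: "'a::nonarch_valued_field \<Rightarrow> bool" where
  "uniformizer p \<longleftrightarrow> valuation_ideal = (\<lambda>x. p * x) ` valuation_ring"

definition residue_order :: "'a::nonarch_valued_field itself \<Rightarrow> nat" where
  "residue_order _ = card ((valuation_ring :: 'a set) //
     {(x, y). x \<in> valuation_ring \<and> y \<in> valuation_ring \<and> x - y \<in> valuation_ideal})"

text \<open>Normalized Haar measure on the additive group of the valuation ring. When the field is
  locally compact this ring is a compact metrizable group, so every finite Borel measure on it
  is automatically regular and regularity need not be demanded.\<close>

definition normalized_haar :: "'a::nonarch_valued_field measure \<Rightarrow> bool" where
  "normalized_haar \<mu> \<longleftrightarrow>
     space \<mu> = valuation_ring \<and>
     sets \<mu> = sets (restrict_space borel valuation_ring) \<and>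
     (\<forall>a\<in>valuation_ring. \<forall>A\<in>sets \<mu>. emeasure \<mu> ((\<lambda>x. a + x) ` A) = emeasure \<mu> A) \<and>
     emeasure \<mu> valuation_ring = 1"

definition discs :: "'a::nonarch_valued_field set set" where
  "discs = {D. D \<subseteq> valuation_ring \<and>
     (\<exists>a. \<exists>k::int. D = cball a (real (residue_order TYPE('a)) powi k))}"

text \<open>The supremum below is over a nonempty set of reals bounded by 1.\<close>

definition discrepancy :: "'a::nonarch_valued_field measure \<Rightarrow> 'a set \<Rightarrow> real" where
  "discrepancy \<mu> X =
     (SUP D\<in>discs. \<bar>real (card (X \<inter> D)) / real (card X) - measure \<mu> D\<bar>)"

definition maximal_subdiscs ::
  "'a::nonarch_valued_field measure \<Rightarrow> 'a set \<Rightarrow> 'a set set" where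
  "maximal_subdiscs \<mu> D =
     {D'\<in>discs. D' \<subseteq> D \<and> measure \<mu> D' = measure \<mu> D / real (residue_order TYPE('a))}"

definition disc_mean ::
  "'a::nonarch_valued_field measure \<Rightarrow> ('a \<Rightarrow> real) \<Rightarrow> 'a set \<Rightarrow> real" where
  "disc_mean \<mu> f D = 1 / measure \<mu> D * (LINT x:D|\<mu>. f x)"

text \<open>The variation may be infinite. In \<open>ennreal\<close> every family is summable, so \<open>infsum\<close>
  is the true sum of the nonnegative terms.\<close>

definition berkovich_variation ::
  "'a::nonarch_valued_field measure \<Rightarrow> ('a \<Rightarrow> real) \<Rightarrow> ennreal" where
  "berkovich_variation \<mu> f =
     (\<Sum>\<^sub>\<infinity>D\<in>discs. \<Sum>\<^sub>\<infinity>D'\<in>maximal_subdiscs \<mu> D.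
        ennreal \<bar>disc_mean \<mu> f D' - disc_mean \<mu> f D\<bar>)"

end

theory Submission
  imports Defs
begin

text \<open>
  Write \<open>m(D)\<close> for the mean of \<open>f\<close> over a disc \<open>D\<close> and \<open>e(D) = |X \<inter> D| / |X| - \<mu>(D)\<close>, and let
  \<open>T\<^sub>n\<close> be the sum of \<open>m(D) e(D)\<close> over the discs \<open>D\<close> of radius \<open>q\<close> to the power \<open>-n\<close>. Then
  \<open>T\<^sub>0 = 0\<close>, and \<open>T\<^sub>n\<close> tends to the integration error because \<open>f\<close> is continuous. Since \<open>e\<close> is
  additive, the increment from \<open>T\<^sub>n\<close> to the next term is the sum of \<open>(m(D') - m(D)) e(D')\<close> over the
  pairs \<open>D' \<prec> D\<close> with \<open>D\<close> of level \<open>n\<close>. As \<open>|e| \<le> \<Delta>(X)\<close>, summing the increments bounds \<open>|T\<^sub>n|\<close> by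
  the variation times the discrepancy, so that even the constant 1 suffices.
\<close>

section \<open>Absolute value and ultrametric balls\<close>

lemma absval_zero [simp]: "absval (0::'a::nonarch_valued_field) = 0"
  using dist_absval[of "0::'a" 0] by simp

lemma absval_eq_0_iff [simp]: "absval x = 0 \<longleftrightarrow> (x::'a::nonarch_valued_field) = 0"
  using dist_absval[of x 0] by (metis diff_zero dist_eq_0_iff)

lemma absval_one [simp]: "absval (1::'a::nonarch_valued_field) = 1"
  using absval_mult[of "1::'a" 1] absval_eq_0_iff[of "1::'a"] by simp

lemma absval_power: "absval (x ^ n) = absval (x::'a::nonarch_valued_field) ^ n"
  by (induction n) (simp_all add: absval_mult)

lemma dist_ultrametric:
  fixes x y z :: "'a::nonarch_valued_field"
  shows "dist x z \<le> max (dist x y) (dist y z)"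
  using absval_ultrametric[of "x - y" "y - z"] by (simp add: dist_absval)

lemma dist_add_cancel_left:
  fixes a x y :: "'a::nonarch_valued_field"
  shows "dist (a + x) (a + y) = dist x y"
  by (simp add: dist_absval)

lemma dist_mult_left:
  fixes a x y :: "'a::nonarch_valued_field"
  shows "dist (a * x) (a * y) = absval a * dist x y"
  by (simp add: dist_absval absval_mult flip: right_diff_distrib)

lemma valuation_ring_eq_cball: "valuation_ring = cball (0::'a::nonarch_valued_field) 1"
  by (simp add: valuation_ring_def cball_def dist_absval[of _ 0] dist_commute[of 0])

text \<open>The strong triangle inequality makes every point of a ball a centre. This is why two
  discs of the same radius are equal or disjoint.\<close>

lemma cball_eq_cball:
  fixes x y :: "'a::nonarch_valued_field"
  assumes "y \<in> cball x r"
  shows "cball y r = cball x r"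
proof -
  have "dist y z \<le> r \<longleftrightarrow> dist x z \<le> r" for z
    using assms dist_ultrametric[of x z y] dist_ultrametric[of y z x] by (auto simp: dist_commute)
  then show ?thesis by auto
qed

text \<open>Used with \<open>b = 1\<close> to translate discs, with \<open>b = p\<close> to identify
  the valuation ideal, and with \<open>b = p ^ n\<close> to transfer counts from level 1 to deeper
  levels.\<close>

lemma image_affine_cball:
  fixes a b x :: "'a::nonarch_valued_field"
  assumes "b \<noteq> 0"
  shows "(\<lambda>y. a + b * y) ` cball x r = cball (a + b * x) (absval b * r)"
proof (intro equalityI subsetI)
  have pos: "absval b > 0"
    using assms zero_le_dist[of b 0] absval_eq_0_iff[of b] by (simp add: dist_absval less_le)
  fix z
  { assume "z \<in> (\<lambda>y. a + b * y) ` cball x r"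
    then show "z \<in> cball (a + b * x) (absval b * r)"
      using pos by (auto simp: dist_add_cancel_left dist_mult_left) }
  assume z: "z \<in> cball (a + b * x) (absval b * r)"
  define y where "y = (z - a) / b"
  have zy: "z = a + b * y"
    using assms by (simp add: y_def)
  with z pos have "y \<in> cball x r"
    by (simp add: dist_add_cancel_left dist_mult_left)
  with zy show "z \<in> (\<lambda>y. a + b * y) ` cball x r"
    by blast
qed

section \<open>Auxiliary facts on sums and counting\<close>

lemma sum_le_infsum_complete:
  fixes f :: "'b \<Rightarrow> 'c :: {complete_linorder, ordered_comm_monoid_add, linorder_topology}"
  assumes "finite B" "B \<subseteq> A" "\<And>x. x \<in> A \<Longrightarrow> 0 \<le> f x"
  shows "sum f B \<le> infsum f A"
  unfolding infsum_finite[OF assms(1), symmetric]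
  using assms by (intro infsum_mono_neutral nonneg_summable_on_complete) auto

lemma card_Int_Union_disjoint:
  assumes "finite X" "finite \<A>" "disjoint \<A>"
  shows "card (X \<inter> \<Union>\<A>) = (\<Sum>D\<in>\<A>. card (X \<inter> D))"
proof -
  have "X \<inter> \<Union>\<A> = (\<Union>D\<in>\<A>. X \<inter> D)" by blast
  then show ?thesis
    using assms by (simp only:) (rule card_UN_disjoint; fastforce simp: disjoint_def)
qed

section \<open>The uniformizer, the residue order and the tree of discs\<close>

locale normalized_haar_field =
  fixes p :: "'a::nonarch_valued_field" and \<mu> :: "'a measure" and q :: nat
  assumes q_def: "q = residue_order TYPE('a)"
    and uniformizer: "uniformizer p"
    and absval_p: "absval p = 1 / real q"
    and haar: "normalized_haar \<mu>"
begin

definition disc :: "nat \<Rightarrow> 'a \<Rightarrow> 'a set" where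
  "disc n x = cball x ((1 / real q) ^ n)"

definition level :: "nat \<Rightarrow> 'a set set" where
  "level n = disc n ` valuation_ring"

lemma valuation_ideal_eq: "valuation_ideal = (\<lambda>x. p * x) ` valuation_ring"
  using uniformizer by (simp add: uniformizer_def)

text \<open>Otherwise the valuation ideal would be trivial and every nonzero element would have
  absolute value at least 1. For an \<open>x\<close> of absolute value other than 1 and its inverse,
  this contradicts that the two values multiply to 1.\<close>

lemma p_nonzero: "p \<noteq> 0"
proof
  assume "p = 0"
  then have triv: "absval x < 1 \<Longrightarrow> x = 0" for x :: 'a
    using valuation_ideal_eq by (auto simp: valuation_ideal_def)
  obtain x :: 'a where x: "x \<noteq> 0" "absval x \<noteq> 1"
    using absval_nontrivial by blast
  have inv: "absval x * absval (inverse x) = 1"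
    using x by (simp flip: absval_mult)
  have "absval x > 1"
    using triv x by (meson linorder_neqE_linordered_idom)
  moreover have "absval (inverse x) \<ge> 1"
    using triv[of "inverse x"] x by force
  ultimately show False
    using inv mult_mono[of 1 "absval x" 1 "absval (inverse x)"]
    by (smt (verit) mult_le_cancel_left1)
qed

lemma q_gt_1: "1 < real q"
proof -
  have "p * 1 \<in> valuation_ideal"
    unfolding valuation_ideal_eq by (rule imageI) (simp add: valuation_ring_def)
  then have "1 / real q < 1"
    by (simp add: valuation_ideal_def absval_p)
  \<comment> \<open>For \<open>q = 0\<close> the convention \<open>1 / 0 = 0\<close> would make
    \<open>absval p\<close> vanish.\<close>
  moreover have "real q \<noteq> 0"
    using absval_p p_nonzero by (metis absval_eq_0_iff div_by_0)
  ultimately show ?thesis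
    by (simp add: field_simps)
qed

lemma disc_0: "disc 0 0 = valuation_ring"
  by (simp add: disc_def valuation_ring_eq_cball)

lemma center_in_disc [simp]: "x \<in> disc n x"
  by (simp add: disc_def)

lemma disc_eq: "y \<in> disc n x \<Longrightarrow> disc n y = disc n x"
  unfolding disc_def by (rule cball_eq_cball)

lemma disc_antimono: "m \<le> n \<Longrightarrow> disc n x \<subseteq> disc m x"
  unfolding disc_def using q_gt_1 by (intro subset_cball power_decreasing) auto

lemma disc_subset_valuation_ring: "x \<in> valuation_ring \<Longrightarrow> disc n x \<subseteq> valuation_ring"
  using disc_antimono[of 0 n x] disc_eq[of x 0 0] by (simp add: disc_0)

lemma level_0: "level 0 = {valuation_ring}"
proof -
  have "disc 0 x = valuation_ring" if "x \<in> valuation_ring" for x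
    using disc_eq[of x 0 0] that by (simp add: disc_0)
  moreover have "(0::'a) \<in> valuation_ring"
    by (simp add: valuation_ring_def)
  ultimately show ?thesis
    unfolding level_def by auto
qed

lemma disc_in_discs: "x \<in> valuation_ring \<Longrightarrow> disc n x \<in> discs"
  using disc_subset_valuation_ring[of x n]
  by (auto simp: discs_def disc_def power_int_minus power_one_over inverse_eq_divide
      simp flip: q_def intro!: exI[of _ x] exI[of _ "- int n"])

lemma level_subset_discs: "level n \<subseteq> discs"
  by (auto simp: level_def disc_in_discs)

lemma disjoint_discs: "disjoint (disc n ` A)"
proof (rule disjointI)
  fix D E assume "D \<in> disc n ` A" "E \<in> disc n ` A" "D \<noteq> E"
  then show "D \<inter> E = {}"
    using disc_eq by (metis disjoint_iff imageE)
qed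

lemma Union_subdiscs:
  assumes "m \<le> n" shows "\<Union> (disc n ` disc m x) = disc m x"
proof -
  have "disc n y \<subseteq> disc m x" if "y \<in> disc m x" for y
    using disc_antimono[OF assms, of y] disc_eq[OF that] by simp
  then show ?thesis
    by (auto intro: center_in_disc)
qed

text \<open>Since the valuation ideal is \<open>p\<close> times the unit ball, it is the disc of
  radius \<open>1 / q\<close> about 0, and the residue classes are its translates.\<close>

lemma card_level_1: "card (level 1) = q"
proof -
  have ideal: "valuation_ideal = disc 1 0"
    using image_affine_cball[OF p_nonzero, of 0 0 1]
    by (simp add: valuation_ideal_eq disc_def valuation_ring_eq_cball absval_p)
  have "{(x, y). x \<in> valuation_ring \<and> y \<in> valuation_ring \<and> x - y \<in> valuation_ideal} `` {x}
      = disc 1 x" if "x \<in> valuation_ring" for x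
    using disc_subset_valuation_ring[OF that, of 1] that dist_commute[of x]
    by (auto simp: ideal disc_def dist_absval)
  then have "(valuation_ring :: 'a set) //
     {(x, y). x \<in> valuation_ring \<and> y \<in> valuation_ring \<and> x - y \<in> valuation_ideal} = level 1"
    by (auto simp: quotient_def level_def)
  then show ?thesis
    by (simp add: q_def residue_order_def)
qed

text \<open>The injective affine map \<open>\<phi>\<close> carries the valuation ring onto
  \<open>disc n x\<close> and the discs of level 1 onto its subdiscs, which reduces the count to the
  residue field.\<close>

lemma card_subdiscs: "card (disc (Suc n) ` disc n x) = q"
proof -
  define \<phi> where "\<phi> = (\<lambda>y. x + p ^ n * y)"
  have "inj \<phi>"
    using p_nonzero by (auto simp: \<phi>_def inj_on_def)
  have \<phi>_disc: "\<phi> ` disc m y = disc (n + m) (\<phi> y)" for m y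
    using image_affine_cball[of "p ^ n" x y] p_nonzero
    by (simp add: \<phi>_def disc_def absval_power absval_p power_add)
  have "disc (Suc n) ` disc n x = disc (Suc n) ` \<phi> ` valuation_ring"
    using \<phi>_disc[of 0 0] by (simp add: disc_0 \<phi>_def)
  also have "\<dots> = (`) \<phi> ` level 1"
    by (auto simp: level_def image_image \<phi>_disc)
  also have "card \<dots> = card (level 1)"
    using \<open>inj \<phi>\<close> by (intro card_image) (simp add: inj_on_def inj_image_eq_iff)
  finally show ?thesis
    using card_level_1 by simp
qed

text \<open>As \<open>card\<close> is 0 on infinite sets, the positive count itself yields
  finiteness.\<close>

lemma finite_subdiscs: "finite (disc (Suc n) ` disc n x)"
  using card_subdiscs[of n x] q_gt_1 by (auto intro: card_ge_0_finite)

lemma level_Suc: "level (Suc n) = (\<Union>D\<in>level n. disc (Suc n) ` D)"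
proof -
  have "(\<Union> (level n)) = valuation_ring"
    using Union_subdiscs[of 0 n 0] by (simp add: level_def disc_0)
  then show ?thesis
    unfolding level_def[of "Suc n"] by blast
qed

lemma finite_level: "finite (level n)"
proof (induction n)
  case 0
  show ?case by (simp add: level_0)
next
  case (Suc n)
  then show ?case
    unfolding level_Suc by (intro finite_UN_I) (auto simp: level_def finite_subdiscs)
qed

lemma sum_level_Suc:
  "sum h (level (Suc n)) = (\<Sum>D\<in>level n. sum h (disc (Suc n) ` D))"
  unfolding level_Suc
proof (rule sum.UNION_disjoint)
  show "finite (level n)"
    by (rule finite_level)
  show "\<forall>D\<in>level n. finite (disc (Suc n) ` D)"
    by (auto simp: level_def finite_subdiscs)
  show "\<forall>D\<in>level n. \<forall>E\<in>level n. D \<noteq> E \<longrightarrow> disc (Suc n) ` D \<inter> disc (Suc n) ` E = {}"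
  proof (intro ballI impI)
    fix D E assume DE: "D \<in> level n" "E \<in> level n" "D \<noteq> E"
    have "D \<inter> E = {}"
      by (rule disjointD[OF disjoint_discs DE[unfolded level_def]])
    \<comment> \<open>\<open>E\<close> is the union of its subdiscs, so a subdisc shared by
      \<open>D\<close> and \<open>E\<close> would put a point in both.\<close>
    have "y \<in> E" if "disc (Suc n) y \<in> disc (Suc n) ` E" for y
    proof -
      have "y \<in> \<Union> (disc (Suc n) ` E)"
        using that center_in_disc by (rule UnionI)
      moreover have "\<Union> (disc (Suc n) ` E) = E"
        using DE Union_subdiscs[of n "Suc n"] by (auto simp: level_def)
      ultimately show ?thesis by simp
    qed
    with \<open>D \<inter> E = {}\<close> show "disc (Suc n) ` D \<inter> disc (Suc n) ` E = {}"
      by blast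
  qed
qed

section \<open>Haar measure of the discs\<close>

lemma finite_measure_haar: "finite_measure \<mu>"
  using haar by (intro finite_measureI) (simp add: normalized_haar_def)

lemma measure_valuation_ring: "measure \<mu> valuation_ring = 1"
  using haar by (simp add: normalized_haar_def measure_def)

lemma measure_le_1: "measure \<mu> A \<le> 1"
  using finite_measure.bounded_measure[OF finite_measure_haar, of A] haar
  by (simp add: normalized_haar_def measure_def)

lemma disc_measurable: "x \<in> valuation_ring \<Longrightarrow> disc n x \<in> sets \<mu>"
  using haar disc_subset_valuation_ring[of x n]
  by (auto simp: normalized_haar_def sets_restrict_space disc_def intro!: image_eqI[of _ _ "cball x _"])

lemma measure_disc_eq:
  assumes "x \<in> valuation_ring" shows "measure \<mu> (disc n x) = measure \<mu> (disc n 0)"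
proof -
  have "disc n x = (\<lambda>y. x + y) ` disc n 0"
    using image_affine_cball[of 1 x 0] by (simp add: disc_def)
  moreover have "disc n 0 \<in> sets \<mu>"
    by (intro disc_measurable) (simp add: valuation_ring_def)
  ultimately show ?thesis
    using haar assms by (simp add: normalized_haar_def measure_def)
qed

lemma measure_disc_subdiscs:
  assumes "x \<in> valuation_ring"
  shows "measure \<mu> (disc n x) = (\<Sum>D\<in>disc (Suc n) ` disc n x. measure \<mu> D)"
proof -
  interpret finite_measure \<mu> by (rule finite_measure_haar)
  have "measure \<mu> (\<Union> (disc (Suc n) ` disc n x)) = (\<Sum>D\<in>disc (Suc n) ` disc n x. measure \<mu> D)"
    using disc_subset_valuation_ring[OF assms, of n]
    by (intro measure_Union')
      (auto intro!: disc_measurable disjoint_discs simp: fmeasurable_eq_sets finite_subdiscs)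
  then show ?thesis
    by (simp add: Union_subdiscs)
qed

text \<open>By translation invariance the \<open>q\<close> subdiscs have equal measure, so each
  receives an equal share.\<close>

lemma measure_disc_Suc:
  assumes "x \<in> valuation_ring"
  shows "measure \<mu> (disc (Suc n) x) = measure \<mu> (disc n x) / real q"
proof -
  have "measure \<mu> D = measure \<mu> (disc (Suc n) x)" if "D \<in> disc (Suc n) ` disc n x" for D
    using that disc_subset_valuation_ring[OF assms, of n] assms
    by (auto simp: measure_disc_eq[of _ "Suc n"])
  then have "measure \<mu> (disc n x) = real q * measure \<mu> (disc (Suc n) x)"
    by (simp add: measure_disc_subdiscs[OF assms] card_subdiscs)
  then show ?thesis
    using q_gt_1 by simp
qed

lemma measure_disc: "x \<in> valuation_ring \<Longrightarrow> measure \<mu> (disc n x) = (1 / real q) ^ n"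
proof (induction n)
  case 0
  then have "disc 0 x = valuation_ring"
    using level_0 by (auto simp: level_def)
  then show ?case
    by (simp add: measure_valuation_ring)
next
  case (Suc n)
  then show ?case by (simp add: measure_disc_Suc)
qed

text \<open>In an ultrametric space one ball can have several radii, so the levels are told apart by
  the measure of their discs instead.\<close>

lemma level_disjoint:
  assumes "m \<noteq> n" shows "level m \<inter> level n = {}"
proof -
  have "(1 / real q) ^ m \<noteq> (1 / real q) ^ n"
    using assms q_gt_1 power_inject_exp'[of "1 / real q" m n] by auto
  then show ?thesis
    by (auto simp: level_def) (metis measure_disc)
qed

section \<open>Finitely many levels inside the Berkovich variation\<close>

lemma subdiscs_subset_maximal_subdiscs:
  assumes "D \<in> level n"
  shows "disc (Suc n) ` D \<subseteq> maximal_subdiscs \<mu> D"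
proof
  fix E assume E: "E \<in> disc (Suc n) ` D"
  obtain x where x: "x \<in> valuation_ring" "D = disc n x"
    using assms by (auto simp: level_def)
  obtain y where y: "y \<in> D" "E = disc (Suc n) y"
    using E by blast
  have "y \<in> valuation_ring"
    using x y disc_subset_valuation_ring by blast
  moreover have "E \<subseteq> D"
    using E Union_subdiscs[of n "Suc n" x] x by auto
  moreover have "D = disc n y"
    using disc_eq x y by simp
  ultimately show "E \<in> maximal_subdiscs \<mu> D"
    using y by (auto simp: maximal_subdiscs_def disc_in_discs measure_disc_Suc simp flip: q_def)
qed

text \<open>The levels are finite and pairwise disjoint, so each disc is counted once. As all terms
  are nonnegative, both the inner and the outer finite sum lie below the corresponding infinite
  one.\<close>

lemma sum_levels_le_berkovich_variation:
  "(\<Sum>n<N. \<Sum>D\<in>level n. \<Sum>E\<in>disc (Suc n) ` D. ennreal \<bar>disc_mean \<mu> f E - disc_mean \<mu> f D\<bar>)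
    \<le> berkovich_variation \<mu> f"
proof -
  let ?t = "\<lambda>D. \<Sum>\<^sub>\<infinity>E\<in>maximal_subdiscs \<mu> D. ennreal \<bar>disc_mean \<mu> f E - disc_mean \<mu> f D\<bar>"
  have "(\<Sum>n<N. \<Sum>D\<in>level n. \<Sum>E\<in>disc (Suc n) ` D. ennreal \<bar>disc_mean \<mu> f E - disc_mean \<mu> f D\<bar>)
      \<le> (\<Sum>n<N. \<Sum>D\<in>level n. ?t D)"
  proof (intro sum_mono)
    fix n D assume D: "D \<in> level n"
    have "finite (disc (Suc n) ` D)"
      using D by (auto simp: level_def finite_subdiscs)
    then show "(\<Sum>E\<in>disc (Suc n) ` D. ennreal \<bar>disc_mean \<mu> f E - disc_mean \<mu> f D\<bar>) \<le> ?t D"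
      by (intro sum_le_infsum_complete subdiscs_subset_maximal_subdiscs[OF D])
        auto
  qed
  also have "\<dots> = (\<Sum>D\<in>(\<Union>n<N. level n). ?t D)"
    by (rule sum.UNION_disjoint[symmetric]) (auto simp: finite_level dest: level_disjoint)
  also have "\<dots> \<le> (\<Sum>\<^sub>\<infinity>D\<in>discs. ?t D)"
    using level_subset_discs
    by (intro sum_le_infsum_complete) (auto simp: finite_level)
  finally show ?thesis
    by (simp add: berkovich_variation_def)
qed

section \<open>Means of the integrand over discs\<close>

lemma set_integrable_disc:
  fixes f :: "'a \<Rightarrow> real"
  assumes "integrable \<mu> f" "x \<in> valuation_ring"
  shows "set_integrable \<mu> (disc n x) f"
  unfolding set_integrable_def
  by (rule integrable_mult_indicator[OF disc_measurable[OF assms(2)] assms(1)])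

text \<open>The discs of a level partition the valuation ring. Hence the measure part of
  \<open>level_error\<close>, introduced below, is the same at every level.\<close>

lemma sum_disc_mean_level:
  assumes f: "integrable \<mu> f"
  shows "(\<Sum>D\<in>level n. disc_mean \<mu> f D * measure \<mu> D) = (LINT x|\<mu>. f x)"
proof -
  have "(\<Sum>D\<in>level n. disc_mean \<mu> f D * measure \<mu> D) = (\<Sum>D\<in>level n. LINT x:D|\<mu>. f x)"
    using q_gt_1 by (intro sum.cong) (auto simp: disc_mean_def level_def measure_disc)
  also have "\<dots> = (LINT x:(\<Union>D\<in>level n. D)|\<mu>. f x)"
    using disjoint_discs[of n valuation_ring] finite_level
    by (intro set_integral_finite_Union[symmetric])
      (auto simp: level_def disc_measurable set_integrable_disc[OF f] disjoint_family_on_def disjoint_def)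
  also have "(\<Union>D\<in>level n. D) = space \<mu>"
    using Union_subdiscs[of 0 n 0] haar by (simp add: level_def disc_0 normalized_haar_def)
  finally show ?thesis
    using f by (simp add: set_integral_space)
qed

lemma disc_mean_tendsto:
  assumes f: "integrable \<mu> f" and cont: "continuous_on valuation_ring f" and x: "x \<in> valuation_ring"
  shows "(\<lambda>n. disc_mean \<mu> f (disc n x)) \<longlonglongrightarrow> f x"
proof (rule LIMSEQ_I)
  interpret finite_measure \<mu> by (rule finite_measure_haar)
  fix e :: real assume "e > 0"
  \<comment> \<open>Integrating a pointwise bound gives only a weak inequality for the mean; halving
    \<open>e\<close> restores the strict one demanded by the limit.\<close>
  then obtain d where d: "d > 0" "\<And>y. y \<in> valuation_ring \<Longrightarrow> dist y x < d \<Longrightarrow> dist (f y) (f x) < e / 2"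
    using cont x unfolding continuous_on_iff by (meson half_gt_zero)
  obtain N where N: "(1 / real q) ^ N < d"
    using real_arch_pow_inv[of d "1 / real q"] d q_gt_1 by auto
  have "norm (disc_mean \<mu> f (disc n x) - f x) < e" if "n \<ge> N" for n
  proof -
    let ?D = "disc n x"
    have meas: "measure \<mu> ?D > 0"
      using q_gt_1 by (simp add: measure_disc[OF x])
    have close: "\<bar>f y - f x\<bar> \<le> e / 2" if "y \<in> ?D" for y
    proof -
      have "y \<in> disc N x"
        using that disc_antimono[OF \<open>n \<ge> N\<close>] by blast
      then have "dist y x < d"
        using N by (simp add: disc_def dist_commute)
      then show ?thesis
        using d(2)[of y] that disc_subset_valuation_ring[OF x] by (force simp: dist_real_def)
    qed
    have int: "set_integrable \<mu> ?D f" "set_integrable \<mu> ?D (\<lambda>_. c)" for c :: real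
      using set_integrable_disc[OF f x] set_integrable_disc[OF integrable_const x] by auto
    have const: "(LINT y:?D|\<mu>. c) = c * measure \<mu> ?D" for c :: real
      using disc_measurable[OF x] by (simp add: set_lebesgue_integral_def)
    have "(LINT y:?D|\<mu>. f y) \<le> (LINT y:?D|\<mu>. f x + e / 2)"
      using close by (intro set_integral_mono int) (smt (verit))
    moreover have "(LINT y:?D|\<mu>. f x - e / 2) \<le> (LINT y:?D|\<mu>. f y)"
      using close by (intro set_integral_mono int) (smt (verit))
    ultimately have "f x - e / 2 \<le> disc_mean \<mu> f ?D" "disc_mean \<mu> f ?D \<le> f x + e / 2"
      using meas unfolding const disc_mean_def by (simp_all add: field_simps)
    then show ?thesis
      using \<open>e > 0\<close> by (simp add: abs_if)
  qed
  then show "\<exists>N. \<forall>n\<ge>N. norm (disc_mean \<mu> f (disc n x) - f x) < e"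
    by blast
qed

section \<open>Excess of a disc and telescoping over the levels\<close>

context
  fixes f :: "'a \<Rightarrow> real" and X :: "'a set"
  assumes finite_X: "finite X" and X_nonempty: "X \<noteq> {}" and X_subset: "X \<subseteq> valuation_ring"
begin

text \<open>Kept signed, so that it is additive over disjoint discs; absolute values are taken only
  after telescoping.\<close>

definition excess :: "'a set \<Rightarrow> real" where
  "excess D = real (card (X \<inter> D)) / real (card X) - measure \<mu> D"

text \<open>A real supremum dominates its terms once they are bounded above. The bound 1 serves, as
  both the proportion of points and the measure lie between 0 and 1.\<close>

lemma abs_excess_le_discrepancy:
  assumes "D \<in> discs" shows "\<bar>excess D\<bar> \<le> discrepancy \<mu> X"
  unfolding discrepancy_def excess_def
proof (rule cSUP_upper[OF assms], rule bdd_aboveI2)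
  fix D :: "'a set"
  have "card (X \<inter> D) \<le> card X"
    using finite_X by (intro card_mono) auto
  then have "real (card (X \<inter> D)) / real (card X) \<le> 1"
    by (simp add: divide_le_eq_1 card_gt_0_iff finite_X X_nonempty)
  moreover have "0 \<le> real (card (X \<inter> D)) / real (card X)"
    by simp
  ultimately show "\<bar>real (card (X \<inter> D)) / real (card X) - measure \<mu> D\<bar> \<le> 1"
    using measure_le_1[of D] measure_nonneg[of \<mu> D] by linarith
qed

lemma excess_subdiscs:
  assumes "D \<in> level n" shows "sum excess (disc (Suc n) ` D) = excess D"
proof -
  obtain x where x: "x \<in> valuation_ring" "D = disc n x"
    using assms by (auto simp: level_def)
  show ?thesis
    using card_Int_Union_disjoint[OF finite_X finite_subdiscs disjoint_discs, of n x]
      measure_disc_subdiscs[OF x(1), of n]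
    by (simp add: x(2) excess_def[abs_def] sum_subtractf Union_subdiscs sum_divide_distrib)
qed

text \<open>This is \<open>T\<close> at level \<open>n\<close> from the overview: for integrable
  \<open>f\<close>, the integration error of the step function that replaces \<open>f\<close> by its
  mean on each disc of level \<open>n\<close>.\<close>

definition level_error :: "nat \<Rightarrow> real" where
  "level_error n = (\<Sum>D\<in>level n. disc_mean \<mu> f D * excess D)"

text \<open>Additivity of the excess spreads each term of level \<open>n\<close> over the subdiscs,
  where it is compared with the term of the next level.\<close>

lemma level_error_Suc:
  "level_error (Suc n) - level_error n
    = (\<Sum>D\<in>level n. \<Sum>E\<in>disc (Suc n) ` D. (disc_mean \<mu> f E - disc_mean \<mu> f D) * excess E)"
proof -
  have "level_error n = (\<Sum>D\<in>level n. \<Sum>E\<in>disc (Suc n) ` D. disc_mean \<mu> f D * excess E)"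
    unfolding level_error_def
    by (intro sum.cong) (simp_all add: excess_subdiscs flip: sum_distrib_left)
  then show ?thesis
    by (simp add: level_error_def[of "Suc n"] sum_level_Suc left_diff_distrib sum_subtractf)
qed

lemma level_error_0: "level_error 0 = 0"
proof -
  have "X \<inter> valuation_ring = X" using X_subset by blast
  then show ?thesis
    using finite_X X_nonempty by (simp add: measure_valuation_ring level_error_def level_0 excess_def)
qed

lemma abs_level_error_le:
  "\<bar>level_error N\<bar>
    \<le> (\<Sum>n<N. \<Sum>D\<in>level n. \<Sum>E\<in>disc (Suc n) ` D. \<bar>disc_mean \<mu> f E - disc_mean \<mu> f D\<bar>)
      * discrepancy \<mu> X"
proof -
  \<comment> \<open>The sum telescopes without a boundary term because \<open>level_error 0\<close>
    vanishes.\<close>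
  have "\<bar>level_error N\<bar> = \<bar>\<Sum>n<N. level_error (Suc n) - level_error n\<bar>"
    by (simp add: sum_lessThan_telescope level_error_0)
  also have "\<dots> \<le> (\<Sum>n<N. \<Sum>D\<in>level n. \<Sum>E\<in>disc (Suc n) ` D.
      \<bar>(disc_mean \<mu> f E - disc_mean \<mu> f D) * excess E\<bar>)"
    unfolding level_error_Suc by (intro order.trans[OF sum_abs] sum_mono order.refl)
  also have "\<dots> \<le> (\<Sum>n<N. \<Sum>D\<in>level n. \<Sum>E\<in>disc (Suc n) ` D.
      \<bar>disc_mean \<mu> f E - disc_mean \<mu> f D\<bar> * discrepancy \<mu> X)"
  proof (intro sum_mono)
    fix n D E assume "D \<in> level n" "E \<in> disc (Suc n) ` D"
    then have "E \<in> discs"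
      using level_subset_discs[of "Suc n"] by (auto simp: level_Suc)
    then show "\<bar>(disc_mean \<mu> f E - disc_mean \<mu> f D) * excess E\<bar>
        \<le> \<bar>disc_mean \<mu> f E - disc_mean \<mu> f D\<bar> * discrepancy \<mu> X"
      by (simp add: abs_mult abs_excess_le_discrepancy mult_left_mono)
  qed
  finally show ?thesis
    by (simp add: sum_distrib_right)
qed

text \<open>The estimate moves to \<open>ennreal\<close> only here, after the finite real sums are
  done, because the variation may be infinite.\<close>

lemma ennreal_abs_level_error_le:
  "ennreal \<bar>level_error N\<bar> \<le> berkovich_variation \<mu> f * ennreal (discrepancy \<mu> X)"
proof -
  have "ennreal \<bar>level_error N\<bar>
    \<le> ennreal (\<Sum>n<N. \<Sum>D\<in>level n. \<Sum>E\<in>disc (Suc n) ` D. \<bar>disc_mean \<mu> f E - disc_mean \<mu> f D\<bar>)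
      * ennreal (discrepancy \<mu> X)"
    using ennreal_leI[OF abs_level_error_le[of N]]
    by (subst (asm) ennreal_mult') (auto intro!: sum_nonneg)
  also have "\<dots> \<le> berkovich_variation \<mu> f * ennreal (discrepancy \<mu> X)"
    using sum_levels_le_berkovich_variation[of f N]
    by (intro mult_right_mono) (simp_all add: sum_ennreal sum_nonneg)
  finally show ?thesis .
qed

section \<open>Limit of the level errors\<close>

lemma sum_disc_mean_card:
  "(\<Sum>D\<in>level n. disc_mean \<mu> f D * real (card (X \<inter> D))) = (\<Sum>x\<in>X. disc_mean \<mu> f (disc n x))"
proof -
  \<comment> \<open>The points of \<open>X\<close> are grouped by the disc of level \<open>n\<close>
    around them; as every point of a disc is its centre, the group belonging to \<open>D\<close> is
    \<open>X \<inter> D\<close>.\<close>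
  have "(\<Sum>x\<in>X. disc_mean \<mu> f (disc n x))
      = (\<Sum>D\<in>level n. \<Sum>x\<in>{x \<in> X. disc n x = D}. disc_mean \<mu> f (disc n x))"
    using X_subset by (intro sum.group[symmetric] finite_X finite_level) (auto simp: level_def)
  also have "\<dots> = (\<Sum>D\<in>level n. disc_mean \<mu> f D * real (card (X \<inter> D)))"
  proof (rule sum.cong[OF refl])
    fix D assume "D \<in> level n"
    then have fibre: "{x \<in> X. disc n x = D} = X \<inter> D"
      using disc_eq by (auto simp: level_def)
    have "(\<Sum>x\<in>{x \<in> X. disc n x = D}. disc_mean \<mu> f (disc n x))
        = (\<Sum>x\<in>{x \<in> X. disc n x = D}. disc_mean \<mu> f D)"
      by (rule sum.cong) auto
    then show "(\<Sum>x\<in>{x \<in> X. disc n x = D}. disc_mean \<mu> f (disc n x))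
        = disc_mean \<mu> f D * real (card (X \<inter> D))"
      by (simp add: fibre)
  qed
  finally show ?thesis by simp
qed

text \<open>The counting part is an average over the finite set \<open>X\<close> of disc means, each
  tending to the value of \<open>f\<close> at its point, while the measure part is constant in
  \<open>n\<close>.\<close>

lemma level_error_tendsto:
  assumes f: "integrable \<mu> f" and cont: "continuous_on valuation_ring f"
  shows "level_error \<longlonglongrightarrow> (\<Sum>x\<in>X. f x) / real (card X) - (LINT x|\<mu>. f x)"
proof -
  have "level_error = (\<lambda>n. (\<Sum>x\<in>X. disc_mean \<mu> f (disc n x)) / real (card X) - (LINT x|\<mu>. f x))"
    by (simp add: fun_eq_iff level_error_def excess_def right_diff_distrib sum_subtractf
        sum_disc_mean_level[OF f] flip: sum_disc_mean_card sum_divide_distrib)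
  moreover have "(\<lambda>n. (\<Sum>x\<in>X. disc_mean \<mu> f (disc n x)) / real (card X) - (LINT x|\<mu>. f x))
      \<longlonglongrightarrow> (\<Sum>x\<in>X. f x) / real (card X) - (LINT x|\<mu>. f x)"
    using X_subset finite_X X_nonempty
    by (intro tendsto_intros disc_mean_tendsto f cont) auto
  ultimately show ?thesis
    by (simp only:)
qed

text \<open>The bound on the level errors is uniform in the level and therefore passes to the
  limit.\<close>

lemma koksma_hlawka:
  assumes "integrable \<mu> f" "continuous_on valuation_ring f"
  shows "ennreal \<bar>(\<Sum>x\<in>X. f x) / real (card X) - (LINT x|\<mu>. f x)\<bar>
    \<le> berkovich_variation \<mu> f * ennreal (discrepancy \<mu> X)"
proof (rule tendsto_upperbound)
  show "(\<lambda>n. ennreal \<bar>level_error n\<bar>)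
      \<longlonglongrightarrow> ennreal \<bar>(\<Sum>x\<in>X. f x) / real (card X) - (LINT x|\<mu>. f x)\<bar>"
    by (intro tendsto_ennrealI tendsto_rabs level_error_tendsto assms)
qed (simp_all add: ennreal_abs_level_error_le)

end

end

theorem theorem5p7:
  fixes p :: "'a::nonarch_valued_field"
    and \<mu> :: "'a measure"
    and f :: "'a \<Rightarrow> real"
    and X :: "'a set"
    and q :: nat
  assumes "locally compact (UNIV :: 'a set)"
    and "q = residue_order TYPE('a)"
    and "uniformizer p" and "absval p = 1 / real q"
    and "normalized_haar \<mu>"
    and "continuous_on valuation_ring f" and "integrable \<mu> f"
    and "finite X" and "X \<noteq> {}" and "X \<subseteq> valuation_ring"
  shows "ennreal \<bar>(\<Sum>x\<in>X. f x) / real (card X) - (LINT x|\<mu>. f x)\<bar>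
    \<le> ennreal (1 + 1 / real q) * berkovich_variation \<mu> f * ennreal (discrepancy \<mu> X)"
proof -
  interpret normalized_haar_field p \<mu> q
    by unfold_locales (fact assms)+
  have "ennreal \<bar>(\<Sum>x\<in>X. f x) / real (card X) - (LINT x|\<mu>. f x)\<bar>
      \<le> berkovich_variation \<mu> f * ennreal (discrepancy \<mu> X)"
    by (rule koksma_hlawka) (fact assms)+
  \<comment> \<open>The factor \<open>1 + 1 / real q\<close> is at least 1, so the estimate with
    constant 1 implies the stated one.\<close>
  also have "1 * berkovich_variation \<mu> f
      \<le> ennreal (1 + 1 / real q) * berkovich_variation \<mu> f"
    by (intro mult_right_mono) (simp_all flip: ennreal_1)
  then have "berkovich_variation \<mu> f * ennreal (discrepancy \<mu> X)
      \<le> ennreal (1 + 1 / real q) * berkovich_variation \<mu> f * ennreal (discrepancy \<mu> X)"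
    by (intro mult_right_mono) simp_all
  finally show ?thesis .
qed

end
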